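(* The parameter $F_3$ is unbounded, i.e. $F_3=\infty$. Moreover, there exist distinct integers $a_1,a_2,a_3$ with infinitely many translates into the set of perfect rational squares; that is, there are infinitely many $x\in\mathbb{Q}$ such that $a_1+x$, $a_2+x$ and $a_3+x$ all belong to $\{q^2: q\in\mathbb{Q}\}$.
   Context: $F_3=\max_{A\subset\mathbb{Z},|A|=3}\#\{x\in\mathbb{Z}: a+x \text{ is the square of an integer for every } a\in A\}$, with $F_3=\infty$ meaning that these numbers are unbounded over all $3$-element sets $A\subset \mathbb{Z}$. *)

theory Defs
  imports Complex_Main "HOL-Library.Extended_Nat"
begin

definition square_translates :: "int set \<Rightarrow> int set" where
  "square_translates A = {x. \<forall>a\<in>A. \<exists>m::int. a + x = m\<^sup>2}"

text \<open>Two distinct elements of \<open>A\<close> already leave only finitely many translates, so the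
  truncation of \<^const>\<open>card\<close> to 0 on infinite sets plays no role in the definition of \<open>F\<^sub>3\<close> below.\<close>

lemma finite_square_translates:
  assumes "a \<in> A" "b \<in> A" "a \<noteq> b"
  shows "finite (square_translates A)"
proof -
  let ?d = "\<bar>a - b\<bar>"
  have "square_translates A \<subseteq> (\<lambda>m. m\<^sup>2 - a) ` {-?d..?d}"
  proof
    fix x assume "x \<in> square_translates A"
    then obtain m n where m: "a + x = m\<^sup>2" and n: "b + x = n\<^sup>2"
      using assms unfolding square_translates_def by blast
    have eq: "a - b = (m - n) * (m + n)"
      using m n by (simp add: algebra_simps power2_eq_square)
    then have nz: "m - n \<noteq> 0" "m + n \<noteq> 0" using assms(3) by auto
    have d: "?d = \<bar>m - n\<bar> * \<bar>m + n\<bar>" using eq by (simp add: abs_mult)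
    have "\<bar>m - n\<bar> \<le> ?d" "\<bar>m + n\<bar> \<le> ?d"
      using nz mult_left_mono[of 1 "\<bar>m + n\<bar>" "\<bar>m - n\<bar>"] mult_right_mono[of 1 "\<bar>m - n\<bar>" "\<bar>m + n\<bar>"]
      unfolding d by auto
    then have "m \<in> {-?d..?d}" by auto
    moreover have "x = m\<^sup>2 - a" using m by simp
    ultimately show "x \<in> (\<lambda>m. m\<^sup>2 - a) ` {-?d..?d}" by blast
  qed
  then show ?thesis by (rule finite_subset) simp
qed

text \<open>The maximum is rendered as a supremum in \<^typ>\<open>enat\<close>, which is \<open>\<infinity>\<close> exactly when the
  cardinalities are unbounded and is attained otherwise.\<close>

definition F3 :: enat where
  "F3 = (SUP A\<in>{A :: int set. card A = 3}. enat (card (square_translates A)))"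

end

theory Submission
  imports Defs
begin

text \<open>
  Take three integers in arithmetic progression: if \<open>s\<close> is rational and \<open>s\<^sup>2 - n\<close>, \<open>s\<^sup>2\<close>,
  \<open>s\<^sup>2 + n\<close> are all squares, then \<open>x = s\<^sup>2\<close> is a translate of \<open>{-n, 0, n}\<close> into the rational
  squares. Such \<open>x\<close> are first coordinates of points on the congruent number curve
  \<open>y\<^sup>2 = x (x\<^sup>2 - n\<^sup>2)\<close>, and doubling a point produces another one, since
  \<open>(x\<^sup>2 + n\<^sup>2)\<^sup>2 \<plusminus> 4 * n * x * (x\<^sup>2 - n\<^sup>2) = (x\<^sup>2 \<plusminus> 2 * n * x - n\<^sup>2)\<^sup>2\<close>.
  On numerators and denominators (\<open>s = p / q\<close>) this is the lemma \<open>square_progression_double\<close>.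

  No height function or torsion theorem is needed to see that the doubled points never repeat: if
  \<open>p\<close> is odd and \<open>q\<close> is even, then the new numerator is again odd and the new denominator is
  divisible by \<open>2 * q\<close>, so the power of 2 in the denominator strictly increases. Starting from
  \<open>n = 6\<close>, \<open>s = 5 / 2\<close> (with \<open>1 / 4\<close>, \<open>25 / 4\<close>, \<open>49 / 4\<close>) gives infinitely many \<open>x\<close>.

  Since every denominator divides the later ones, any \<open>N\<close> of them have a common multiple
  \<open>d\<close> further along the sequence. Multiplying by \<open>d\<^sup>2\<close> turns the first \<open>N\<close> rational translates of
  \<open>{-6, 0, 6}\<close> into integral translates of \<open>{-6 * d\<^sup>2, 0, 6 * d\<^sup>2}\<close>, so \<open>F3\<close> is unbounded.
\<close>

text \<open>The fraction \<open>p / q\<close> has the property that \<open>(p / q)\<^sup>2 - n\<close> and \<open>(p / q)\<^sup>2 + n\<close> are rational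
  squares, written with the denominator \<open>q\<^sup>2\<close> cleared. The parity conditions make the power of 2
  in the denominator visible without requiring \<open>p\<close> and \<open>q\<close> to be coprime.\<close>

definition square_progression :: "int \<Rightarrow> int \<Rightarrow> int \<Rightarrow> bool" where
  "square_progression n p q \<longleftrightarrow> odd p \<and> even q \<and> q \<noteq> 0 \<and>
     (\<exists>u. p\<^sup>2 - n * q\<^sup>2 = u\<^sup>2) \<and> (\<exists>v. p\<^sup>2 + n * q\<^sup>2 = v\<^sup>2)"

lemma square_progression_double:
  assumes "square_progression n p q"
  shows "\<exists>p' q'. square_progression n p' q' \<and> 2 * q dvd q'"
proof -
  obtain u v where p: "odd p" and q: "even q" "q \<noteq> 0"
    and u: "p\<^sup>2 - n * q\<^sup>2 = u\<^sup>2" and v: "p\<^sup>2 + n * q\<^sup>2 = v\<^sup>2"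
    using assms unfolding square_progression_def by blast
  have "odd (u\<^sup>2)" "odd (v\<^sup>2)"
    using p q by (simp_all flip: u v)
  then have nz: "p \<noteq> 0" "u \<noteq> 0" "v \<noteq> 0"
    using p by auto
  define p' where "p' = p ^ 4 + n\<^sup>2 * q ^ 4"
  define q' where "q' = 2 * q * (p * u * v)"
  have q'2: "q'\<^sup>2 = 4 * q\<^sup>2 * p\<^sup>2 * ((p\<^sup>2 - n * q\<^sup>2) * (p\<^sup>2 + n * q\<^sup>2))"
    unfolding q'_def u v by (simp add: power_mult_distrib)
  have "p'\<^sup>2 - n * q'\<^sup>2 = (p ^ 4 - 2 * n * p\<^sup>2 * q\<^sup>2 - n\<^sup>2 * q ^ 4)\<^sup>2"
    "p'\<^sup>2 + n * q'\<^sup>2 = (p ^ 4 + 2 * n * p\<^sup>2 * q\<^sup>2 - n\<^sup>2 * q ^ 4)\<^sup>2"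
    unfolding p'_def q'2 by algebra+
  moreover have "odd p'" "even q'" "q' \<noteq> 0"
    using p q nz by (simp_all add: p'_def q'_def)
  ultimately have "square_progression n p' q'"
    unfolding square_progression_def by blast
  moreover have "2 * q dvd q'"
    by (simp add: q'_def)
  ultimately show ?thesis by blast
qed

lemma square_progression_sequence:
  obtains p q :: "nat \<Rightarrow> int"
  where "\<And>k. square_progression 6 (p k) (q k)" "\<And>i j. i < j \<Longrightarrow> 2 * q i dvd q j"
proof -
  have "square_progression 6 5 2"
    unfolding square_progression_def
    by (intro conjI exI[of _ 1] exI[of _ 7]) simp_all
  then have "\<exists>f. \<forall>k. square_progression 6 (fst (f k)) (snd (f k)) \<and>
      2 * snd (f k) dvd snd (f (Suc k))"
    using square_progression_double
    by (intro dependent_nat_choice[where P = "\<lambda>_ z. square_progression 6 (fst z) (snd z)"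
        and Q = "\<lambda>_ z w. 2 * snd z dvd snd w"]) (force, simp)
  then obtain f where f: "\<And>k. square_progression 6 (fst (f k)) (snd (f k))"
    and step: "\<And>k. 2 * snd (f k) dvd snd (f (Suc k))"
    by blast
  have "2 * snd (f i) dvd snd (f j)" if "i < j" for i j
    using that
  proof (induction rule: strict_inc_induct)
    case (base i)
    then show ?case using step[of i] by simp
  next
    case (step i)
    then show ?case
      using \<open>2 * snd (f i) dvd snd (f (Suc i))\<close> by (meson dvd_trans dvd_mult_right)
  qed
  with f that[of "fst \<circ> f" "snd \<circ> f"] show thesis by simp
qed

text \<open>In lowest terms the denominator of \<open>p' / q'\<close> contains a higher power of 2 than that of
  \<open>p / q\<close>. Hence the two squares differ.\<close>

lemma square_quotients_distinct:
  fixes p q p' q' :: int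
  assumes "odd p'" "q \<noteq> 0" "q' \<noteq> 0" "2 * q dvd q'"
  shows "(of_int p / of_int q :: rat)\<^sup>2 \<noteq> (of_int p' / of_int q')\<^sup>2"
proof
  assume eq: "(of_int p / of_int q :: rat)\<^sup>2 = (of_int p' / of_int q')\<^sup>2"
  obtain m where m: "q' = 2 * q * m"
    using assms(4) by blast
  with eq assms have "(of_int p' :: rat)\<^sup>2 = (of_int (2 * m * p))\<^sup>2"
    by (simp add: field_simps power2_eq_square)
  then have "p'\<^sup>2 = (2 * m * p)\<^sup>2"
    by (simp only: of_int_power[symmetric] of_int_eq_iff)
  then have "even (p'\<^sup>2)" by simp
  with \<open>odd p'\<close> show False by simp
qed

lemma square_progression_translate:
  assumes "square_progression n p q"
  shows "{of_int (- n) + (of_int p / of_int q)\<^sup>2, of_int 0 + (of_int p / of_int q)\<^sup>2,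
      of_int n + (of_int p / of_int q)\<^sup>2} \<subseteq> {r\<^sup>2 | r :: rat. True}"
proof -
  obtain u v where q: "q \<noteq> 0"
    and u: "p\<^sup>2 - n * q\<^sup>2 = u\<^sup>2" and v: "p\<^sup>2 + n * q\<^sup>2 = v\<^sup>2"
    using assms unfolding square_progression_def by blast
  have "of_int (- n) + (of_int p / of_int q :: rat)\<^sup>2 = of_int (p\<^sup>2 - n * q\<^sup>2) / of_int (q\<^sup>2)"
    using q by (simp add: field_simps)
  also have "\<dots> = (of_int u / of_int q)\<^sup>2"
    unfolding u by (simp add: power_divide)
  finally have 1: "of_int (- n) + (of_int p / of_int q :: rat)\<^sup>2 = (of_int u / of_int q)\<^sup>2" .
  have "of_int n + (of_int p / of_int q :: rat)\<^sup>2 = of_int (p\<^sup>2 + n * q\<^sup>2) / of_int (q\<^sup>2)"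
    using q by (simp add: field_simps)
  also have "\<dots> = (of_int v / of_int q)\<^sup>2"
    unfolding v by (simp add: power_divide)
  finally have 2: "of_int n + (of_int p / of_int q :: rat)\<^sup>2 = (of_int v / of_int q)\<^sup>2" .
  from 1 2 show ?thesis by auto
qed

lemma square_progression_integral_translate:
  assumes "square_progression n p q"
  shows "(p * c)\<^sup>2 \<in> square_translates {- n * (q * c)\<^sup>2, 0, n * (q * c)\<^sup>2}"
proof -
  obtain u v where u: "p\<^sup>2 - n * q\<^sup>2 = u\<^sup>2" and v: "p\<^sup>2 + n * q\<^sup>2 = v\<^sup>2"
    using assms unfolding square_progression_def by blast
  have "- n * (q * c)\<^sup>2 + (p * c)\<^sup>2 = (p\<^sup>2 - n * q\<^sup>2) * c\<^sup>2"
    by (simp add: algebra_simps)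
  then have 1: "- n * (q * c)\<^sup>2 + (p * c)\<^sup>2 = (u * c)\<^sup>2"
    unfolding u by (simp add: power_mult_distrib)
  have "n * (q * c)\<^sup>2 + (p * c)\<^sup>2 = (p\<^sup>2 + n * q\<^sup>2) * c\<^sup>2"
    by (simp add: algebra_simps)
  then have 2: "n * (q * c)\<^sup>2 + (p * c)\<^sup>2 = (v * c)\<^sup>2"
    unfolding v by (simp add: power_mult_distrib)
  have 3: "0 + (p * c)\<^sup>2 = (p * c)\<^sup>2" by simp
  show ?thesis
    unfolding square_translates_def using 1 2 3 by blast
qed

theorem theorem4p1:
  shows "F3 = \<infinity> \<and>
    (\<exists>a1 a2 a3 :: int. a1 \<noteq> a2 \<and> a1 \<noteq> a3 \<and> a2 \<noteq> a3 \<and>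
      infinite {x :: rat. {of_int a1 + x, of_int a2 + x, of_int a3 + x} \<subseteq> {q\<^sup>2 | q :: rat. True}})"
proof -
  obtain p q :: "nat \<Rightarrow> int" where sp: "\<And>k. square_progression 6 (p k) (q k)"
    and chain: "\<And>i j. i < j \<Longrightarrow> 2 * q i dvd q j"
    using square_progression_sequence by blast
  have p: "odd (p k)" and q: "q k \<noteq> 0" for k
    using sp[of k] by (simp_all add: square_progression_def)
  define X :: "nat \<Rightarrow> rat" where "X k = (of_int (p k) / of_int (q k))\<^sup>2" for k
  have "X i \<noteq> X j" if "i < j" for i j
    unfolding X_def using square_quotients_distinct[OF p q q chain[OF that]] .
  then have inj: "inj X"
    by (metis injI linorder_neqE_nat)

  let ?T = "{x :: rat. {of_int (- 6) + x, of_int 0 + x, of_int 6 + x} \<subseteq> {q\<^sup>2 | q :: rat. True}}"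
  have "range X \<subseteq> ?T"
    using square_progression_translate[OF sp] unfolding X_def by blast
  then have inf: "infinite ?T"
    using range_inj_infinite[OF inj] finite_subset by blast

  have "enat N \<le> F3" for N
  proof -
    \<comment> \<open>The fractions with index below \<open>N\<close> have the common denominator \<open>q N\<close>.\<close>
    define A where "A = {- 6 * (q N)\<^sup>2, 0, 6 * (q N)\<^sup>2}"
    define Y where "Y i = (p i * (q N div q i))\<^sup>2" for i
    have qN: "q N = q i * (q N div q i)" if "i < N" for i
      using chain[OF that] by (metis dvd_mult_div_cancel dvd_mult_right)
    have "Y i \<in> square_translates A" if "i < N" for i
      using square_progression_integral_translate[OF sp, of i "q N div q i"] qN[OF that]
      unfolding A_def Y_def by simp
    then have sub: "Y ` {..<N} \<subseteq> square_translates A" by blast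
    have Y: "of_int (Y i) = X i * (of_int (q N))\<^sup>2" if "i < N" for i
    proof -
      have "(of_int (q N) :: rat) = of_int (q i) * of_int (q N div q i)"
        using qN[OF that] by (metis of_int_mult)
      then show ?thesis
        using q[of i] by (simp add: X_def Y_def power_mult_distrib power_divide)
    qed
    have "inj_on Y {..<N}"
    proof (rule inj_onI)
      fix i j assume ij: "i \<in> {..<N}" "j \<in> {..<N}" "Y i = Y j"
      then have "X i * (of_int (q N))\<^sup>2 = X j * (of_int (q N))\<^sup>2"
        by (metis Y lessThan_iff)
      then show "i = j" using q[of N] inj by (simp add: inj_eq)
    qed
    then have "N = card (Y ` {..<N})" by (simp add: card_image)
    also have "\<dots> \<le> card (square_translates A)"
      using q[of N]
      by (intro card_mono[OF _ sub] finite_square_translates[of 0 _ "6 * (q N)\<^sup>2"])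
        (auto simp: A_def)
    finally have "enat N \<le> enat (card (square_translates A))" by simp
    also have "card A = 3"
      using q[of N] by (simp add: A_def)
    then have "enat (card (square_translates A)) \<le> F3"
      unfolding F3_def by (intro SUP_upper) simp
    finally show ?thesis .
  qed
  then have "F3 = \<infinity>"
    by (metis enat_ord_simps(1) not_infinity_eq Suc_n_not_le_n)
  moreover have "(- 6 :: int) \<noteq> 0" "(- 6 :: int) \<noteq> 6" "(0 :: int) \<noteq> 6" by simp_all
  ultimately show ?thesis using inf by blast
qed

end
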